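(* Let $N\in\mathbb{N}$, $N\ge2$, let $\mathcal{S}=(\sigma(0),\sigma(1),\ldots)\subseteq\mathbb{N}_0$ be a list with $\sigma(0)=0$ such that $m_i:=\sigma(i+1)-\sigma(i)\in\{1,2,\ldots,N-1\}$ for all $i\in\mathbb{N}_0$, let $x_0\in\mathbb{X}$, and let $(x_i)_{i\in\mathbb{N}_0}$, $x_{i+1}=x_{u_N}(m_i;x_i)$, be the closed loop trajectory at the update instants generated by the feedback law $\mu_N^{\mathcal{S}}$. Let $\overline{\alpha}\in(0,1]$ and, for $i\in\mathbb{N}_0$, $$\rho_i:=V_N(x_i)-V_N(x_{u_N}(m_i;x_i))-\overline{\alpha}\sum_{k=0}^{m_i-1}\ell\big(x_{u_N}(k;x_i),u_N(k;x_i)\big),\qquad s_n:=\sum_{i=0}^n\rho_i .$$ Suppose there exist $\alpha_1,\alpha_2\in\mathcal{K}_\infty$ such that $\alpha_2(\|x_i\|_{x^\star})\ge V_N(x_i)$ and $\ell^\star(x_i)\ge\alpha_1(\|x_i\|_{x^\star})$ hold for all $x_i$, $i\in\mathbb{N}_0$. If the sequence $(s_n)_{n\in\mathbb{N}_0}$ converges, then $x_i\to x^\star$ as $i\to\infty$, i.e. $x_{\mu_N^{\mathcal{S}}}(\cdot)$ behaves like a trajectory of an asymptotically stable system. Furthermore, $V_N(x_i)\to0$ as $i\to\infty$.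
   Context: Let $X,U$ be Banach spaces with metrics $d_X,d_U$, let $\mathbb{X}\subset X$, $\mathbb{U}\subset U$ (state and control constraints), and let $f:X\times U\to X$ define the system $x(n+1)=f(x(n),u(n))$, $x(0)=x_0$. For a control sequence $u$, $x_u(\cdot;x_0)$ denotes the resulting trajectory with $x_u(0;x_0)=x_0$. Let $x^\star\in\mathbb{X}$ and $u^\star\in\mathbb{U}$ with $f(x^\star,u^\star)=x^\star$; write $\|x\|_{x^\star}:=d_X(x,x^\star)$. The stage cost $\ell:X\times U\to[0,\infty)$ is continuous, $\ell(x^\star,u^\star)=0$, and $\ell(x,u)>0$ for all $u\in U$ and all $x\ne x^\star$; $\ell^\star(x):=\inf_{u\in\mathbb{U}}\ell(x,u)$. Viability is assumed: for every $x\in\mathbb{X}$ there is $u_x\in\mathbb{U}$ with $f(x,u_x)\in\mathbb{X}$. Finite horizon: $J_N(x_0,u)=\sum_{k=0}^{N-1}\ell(x_u(k;x_0),u(k))$, and $V_N(x_0)$ is the minimum of $J_N(x_0,u)$ over all $u\in\mathbb{U}^N$ with $x_u(k;x_0)\in\mathbb{X}$ for $k=1,\ldots,N$. Minima are assumed to be attained. $u_N(\cdot;x_0)$ denotes a (chosen) minimizer, and $x_{u_N}(\cdot;x_0)$ the corresponding open loop trajectory. Multistep MPC: at each update instant $\sigma(i)$, in state $x_i$, the first $m_i$ elements of $u_N(\cdot;x_i)$ are applied, i.e. $\mu_N^{\mathcal{S}}(k;x_i)=u_N(k;x_i)$ for $k=0,\ldots,m_i-1$. The full closed loop trajectory is $x_{\mu_N^{\mathcal{S}}}(\sigma(i)+k)=x_{u_N}(k;x_i)$,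 $k=0,\ldots,m_i-1$, $i\in\mathbb{N}_0$. $\mathcal{K}_\infty$: continuous, strictly increasing, unbounded functions $\gamma:[0,\infty)\to[0,\infty)$ with $\gamma(0)=0$. $\mathcal{KL}$: continuous $\beta:[0,\infty)^2\to[0,\infty)$ with $\beta(\cdot,t)\in\mathcal{K}_\infty$ for each $t\ge0$ and, for each $r>0$, $\beta(r,\cdot)$ strictly decreasing with $\lim_{t\to\infty}\beta(r,t)=0$. A trajectory $x(\cdot)$ with $x(0)=x_0$ "behaves like a trajectory of an asymptotically stable system" if there is $\beta\in\mathcal{KL}$ with $x(n)\in\mathbb{X}$ and $\|x(n)\|_{x^\star}\le\beta(\|x_0\|_{x^\star},n)$ for all $n\in\mathbb{N}_0$.
   Formalization: The KL estimate is proved at the update instants σ(i); for the full closed loop it is proved only if ℓ* ≥ γ(‖·‖) for some γ∈K_∞ along the whole closed loop, since otherwise intermediate states may be unbounded and the claim fails. *)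

theory Defs
  imports "HOL-Analysis.Analysis"
begin

primrec traj :: "('x \<Rightarrow> 'u \<Rightarrow> 'x) \<Rightarrow> (nat \<Rightarrow> 'u) \<Rightarrow> 'x \<Rightarrow> nat \<Rightarrow> 'x" where
  "traj f u x0 0 = x0"
| "traj f u x0 (Suc n) = f (traj f u x0 n) (u n)"

definition J :: "('x \<Rightarrow> 'u \<Rightarrow> 'x) \<Rightarrow> ('x \<Rightarrow> 'u \<Rightarrow> real) \<Rightarrow> nat \<Rightarrow> 'x \<Rightarrow> (nat \<Rightarrow> 'u) \<Rightarrow> real" where
  "J f l N x0 u = (\<Sum>k<N. l (traj f u x0 k) (u k))"

text \<open>Elements of \<open>UU\<^sup>N\<close> are encoded as infinite sequences of which only the first \<open>N\<close>
  entries are constrained; the entries from \<open>N\<close> on influence neither \<open>J\<close> nor admissibility.\<close>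

definition admissible ::
  "'x set \<Rightarrow> 'u set \<Rightarrow> ('x \<Rightarrow> 'u \<Rightarrow> 'x) \<Rightarrow> nat \<Rightarrow> 'x \<Rightarrow> (nat \<Rightarrow> 'u) set" where
  "admissible XX UU f N x0 =
     {u. (\<forall>k<N. u k \<in> UU) \<and> (\<forall>k\<in>{1..N}. traj f u x0 k \<in> XX)}"

text \<open>The infimum is a minimum wherever a minimizer in the sense of \<open>is_minimizer\<close> exists.\<close>

definition V ::
  "'x set \<Rightarrow> 'u set \<Rightarrow> ('x \<Rightarrow> 'u \<Rightarrow> 'x) \<Rightarrow> ('x \<Rightarrow> 'u \<Rightarrow> real) \<Rightarrow> nat \<Rightarrow> 'x \<Rightarrow> real" where
  "V XX UU f l N x0 = (INF u\<in>admissible XX UU f N x0. J f l N x0 u)"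

definition is_minimizer ::
  "'x set \<Rightarrow> 'u set \<Rightarrow> ('x \<Rightarrow> 'u \<Rightarrow> 'x) \<Rightarrow> ('x \<Rightarrow> 'u \<Rightarrow> real) \<Rightarrow> nat \<Rightarrow> 'x \<Rightarrow> (nat \<Rightarrow> 'u) \<Rightarrow> bool" where
  "is_minimizer XX UU f l N x0 u \<longleftrightarrow>
     is_arg_min (J f l N x0) (\<lambda>v. v \<in> admissible XX UU f N x0) u"

definition l_star :: "'u set \<Rightarrow> ('x \<Rightarrow> 'u \<Rightarrow> real) \<Rightarrow> 'x \<Rightarrow> real" where
  "l_star UU l x = (INF u\<in>UU. l x u)"

text \<open>Comparison functions live on \<open>[0,\<infinity>)\<close>; their values at negative arguments are irrelevant.\<close>

definition K_inf :: "(real \<Rightarrow> real) set" where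
  "K_inf = {\<gamma>. \<gamma> \<in> {0..} \<rightarrow> {0..} \<and> continuous_on {0..} \<gamma> \<and> strict_mono_on {0..} \<gamma> \<and>
               \<gamma> 0 = 0 \<and> \<not> bdd_above (\<gamma> ` {0..})}"

definition KL :: "(real \<Rightarrow> real \<Rightarrow> real) set" where
  "KL = {\<beta>. continuous_on ({0..} \<times> {0..}) (\<lambda>(r, t). \<beta> r t) \<and>
            (\<forall>t\<ge>0. (\<lambda>r. \<beta> r t) \<in> K_inf) \<and>
            (\<forall>r>0. strict_antimono_on {0..} (\<beta> r) \<and> (\<beta> r \<longlongrightarrow> 0) at_top)}"

text \<open>\<open>T\<close> is the set of time instants at which the trajectory is observed. With \<open>T = UNIV\<close> this is
  the property that \<open>x\<close> behaves like a trajectory of an asymptotically stable system.\<close>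

definition behaves_like_as_on ::
  "nat set \<Rightarrow> ('x \<Rightarrow> 'x \<Rightarrow> real) \<Rightarrow> 'x set \<Rightarrow> 'x \<Rightarrow> (nat \<Rightarrow> 'x) \<Rightarrow> bool" where
  "behaves_like_as_on T dX XX xstar x \<longleftrightarrow>
     (\<exists>\<beta>\<in>KL. \<forall>n\<in>T. x n \<in> XX \<and> dX (x n) xstar \<le> \<beta> (dX (x 0) xstar) (real n))"

abbreviation behaves_like_as ::
  "('x \<Rightarrow> 'x \<Rightarrow> real) \<Rightarrow> 'x set \<Rightarrow> 'x \<Rightarrow> (nat \<Rightarrow> 'x) \<Rightarrow> bool" where
  "behaves_like_as \<equiv> behaves_like_as_on UNIV"

end

theory Submission imports Defs begin

text \<open>
  Summing the definition of \<open>\<rho>\<close> telescopes: \<open>V(x\<^sub>0) - s\<^sub>n\<close> equals \<open>V(x\<^sub>n\<^sub>+\<^sub>1)\<close> plus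
  \<open>\<alpha>\<close> times the cost accumulated along the closed loop over the first \<open>n + 1\<close> blocks.  Both terms
  are nonnegative, so convergence of \<open>s\<close> bounds the accumulated cost, and the costs \<open>c\<^sub>i\<close> of the
  individual blocks form a summable sequence (\<open>summable_of_telescoped_decrease\<close>).

  Since \<open>c\<^sub>i\<close> dominates each stage cost of block \<open>i\<close>, and a stage cost dominates \<open>l_star\<close>, the
  bound from below by a function in \<open>K_inf\<close> forces the distance to \<open>xstar\<close> to vanish wherever this
  bound holds: at the update instants always, and along the full closed loop under the additional
  hypothesis.  The upper bound \<open>\<alpha>2\<close> then carries the convergence over to \<open>V\<close>.

  Finally, \<open>KL\<close> is only asked to bound a single trajectory, and convergence to \<open>xstar\<close> nearly
  suffices: a null sequence lies below a continuous, strictly decreasing null function of time, and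
  multiplying that by a linear function of the initial distance gives a function in \<open>KL\<close>
  (\<open>KL_majorant_of_null_sequence\<close>).  The one exception is the initial distance \<open>0\<close>, where every
  function in \<open>KL\<close> vanishes.  Then the upper bound gives \<open>V = 0\<close>, so that all stage costs along the
  optimal trajectory vanish and positivity of \<open>l\<close> keeps the closed loop at \<open>xstar\<close>.
\<close>

section \<open>Comparison functions\<close>

lemma K_inf_nonneg: "\<gamma> \<in> K_inf \<Longrightarrow> 0 \<le> r \<Longrightarrow> 0 \<le> \<gamma> r"
  by (auto simp: K_inf_def)

lemma K_inf_zero: "\<gamma> \<in> K_inf \<Longrightarrow> \<gamma> 0 = 0"
  by (simp add: K_inf_def)

lemma K_inf_less: "\<gamma> \<in> K_inf \<Longrightarrow> 0 \<le> r \<Longrightarrow> r < t \<Longrightarrow> \<gamma> r < \<gamma> t"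
  by (auto simp: K_inf_def strict_mono_on_def)

lemma K_inf_tendsto_zero:
  assumes "\<gamma> \<in> K_inf" and "\<And>n. 0 \<le> d n" and "d \<longlonglongrightarrow> 0"
  shows "(\<lambda>n. \<gamma> (d n)) \<longlonglongrightarrow> 0"
proof -
  have "continuous_on {0..} \<gamma>"
    using assms(1) by (simp add: K_inf_def)
  from continuous_on_tendsto_compose[OF this assms(3)] assms(2) show ?thesis
    by (simp add: K_inf_zero[OF assms(1)])
qed

text \<open>The value \<open>\<gamma> \<epsilon>\<close> is a positive threshold below which \<open>\<gamma> (d n)\<close> forces \<open>d n < \<epsilon>\<close>.\<close>

lemma tendsto_zero_of_K_inf:
  assumes \<gamma>: "\<gamma> \<in> K_inf" and d: "\<And>n. 0 \<le> d n" and lim: "(\<lambda>n. \<gamma> (d n)) \<longlonglongrightarrow> 0"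
  shows "d \<longlonglongrightarrow> 0"
proof (rule order_tendstoI)
  fix \<epsilon> :: real assume "0 < \<epsilon>"
  then have "0 < \<gamma> \<epsilon>"
    using K_inf_less[OF \<gamma>, of 0 \<epsilon>] K_inf_zero[OF \<gamma>] by simp
  from order_tendstoD(2)[OF lim this] show "\<forall>\<^sub>F n in sequentially. d n < \<epsilon>"
  proof eventually_elim
    case (elim n)
    show ?case
    proof (rule ccontr)
      assume "\<not> d n < \<epsilon>"
      then have "\<gamma> \<epsilon> \<le> \<gamma> (d n)"
        using K_inf_less[OF \<gamma>, of \<epsilon> "d n"] \<open>0 < \<epsilon>\<close> by (cases "d n = \<epsilon>") auto
      with elim show False by simp
    qed
  qed
next
  fix \<epsilon> :: real assume "\<epsilon> < 0"
  then have "\<epsilon> < d n" for n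
    using d[of n] by linarith
  then show "\<forall>\<^sub>F n in sequentially. \<epsilon> < d n"
    by simp
qed

lemma linear_in_K_inf:
  assumes "0 < c"
  shows "(\<lambda>r. c * r) \<in> K_inf"
proof -
  have "\<not> bdd_above ((\<lambda>r. c * r) ` {0..})"
  proof
    assume "bdd_above ((\<lambda>r. c * r) ` {0..})"
    then obtain B where B: "\<And>r. 0 \<le> r \<Longrightarrow> c * r \<le> B"
      by (auto simp: bdd_above_def)
    have "c * ((\<bar>B\<bar> + 1) / c) \<le> B"
      using assms by (intro B) simp
    with assms show False by simp
  qed
  then show ?thesis
    using assms by (auto simp: K_inf_def strict_mono_on_def intro!: continuous_intros)
qed

text \<open>The envelope is the supremum of plateaus of height \<open>a k\<close> that end at time \<open>k\<close> and
  descend linearly to \<open>0\<close> on \<open>[k, k + 1]\<close>.  The plateaus are Lipschitz with the common constant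
  \<open>sup a\<close>, hence so is their supremum.  After time \<open>K + 1\<close> those with \<open>k \<le> K\<close> are gone and
  only the small tail values of \<open>a\<close> remain.\<close>

lemma continuous_decreasing_envelope:
  fixes a :: "nat \<Rightarrow> real"
  assumes nonneg: "\<And>n. 0 \<le> a n" and null: "a \<longlonglongrightarrow> 0"
  obtains \<omega> where "continuous_on UNIV \<omega>" "antimono \<omega>" "\<And>t. 0 \<le> \<omega> t"
    "(\<omega> \<longlongrightarrow> 0) at_top" "\<And>n. a n \<le> \<omega> (real n)"
proof -
  obtain A where A: "\<And>n. a n \<le> A"
    using convergent_imp_Bseq[OF convergentI[OF null]] unfolding Bseq_def
    by (metis abs_le_iff real_norm_def)
  have A0: "0 \<le> A"
    using nonneg[of 0] A[of 0] by linarith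
  define p where "p k t = min 1 (max 0 (1 + real k - t))" for k :: nat and t :: real
  have p01: "0 \<le> p k t" "p k t \<le> 1" for k t
    by (auto simp: p_def)
  define \<omega> where "\<omega> t = (SUP k. a k * p k t)" for t
  have below: "a k * p k t \<le> A" for k t
    using mult_mono[OF A[of k] p01(2)[of k t]] A0 p01(1)[of k t] by simp
  have bdd: "bdd_above (range (\<lambda>k. a k * p k t))" for t
    using below by (auto simp: bdd_above_def)
  have upper: "a k * p k t \<le> \<omega> t" for k t
    unfolding \<omega>_def by (rule cSUP_upper[OF UNIV_I bdd])
  have least: "\<omega> t \<le> B" if "\<And>k. a k * p k t \<le> B" for t B
    unfolding \<omega>_def using that by (intro cSUP_least) auto
  have \<omega>0: "0 \<le> \<omega> t" for t
    using upper[of 0 t] mult_nonneg_nonneg[OF nonneg[of 0] p01(1)[of 0 t]] by linarith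
  have anti: "antimono \<omega>"
  proof (rule antimonoI)
    fix t t' :: real assume "t \<le> t'"
    then have "p k t' \<le> p k t" for k
      by (auto simp: p_def)
    then have "a k * p k t' \<le> \<omega> t" for k
      using mult_left_mono[OF _ nonneg, of "p k t'" "p k t" k] upper[of k t] by force
    then show "\<omega> t' \<le> \<omega> t"
      by (rule least)
  qed
  have one_sided: "\<omega> t \<le> \<omega> t' + A * \<bar>t - t'\<bar>" for t t'
  proof (rule least)
    fix k
    have "p k t \<le> p k t' + \<bar>t - t'\<bar>"
      by (auto simp: p_def)
    then have "a k * p k t \<le> a k * p k t' + a k * \<bar>t - t'\<bar>"
      using mult_left_mono[OF _ nonneg[of k]] by (force simp: distrib_left[symmetric])
    also have "\<dots> \<le> \<omega> t' + A * \<bar>t - t'\<bar>"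
      by (intro add_mono upper mult_right_mono A) auto
    finally show "a k * p k t \<le> \<omega> t' + A * \<bar>t - t'\<bar>" .
  qed
  have "A-lipschitz_on UNIV \<omega>"
  proof (rule lipschitz_onI)
    fix t t' :: real
    show "dist (\<omega> t) (\<omega> t') \<le> A * dist t t'"
      using one_sided[of t t'] one_sided[of t' t] by (auto simp: dist_real_def abs_minus_commute)
  qed (fact A0)
  then have cont: "continuous_on UNIV \<omega>"
    by (rule lipschitz_on_continuous_on)
  have lim: "(\<omega> \<longlongrightarrow> 0) at_top"
  proof (rule order_tendstoI)
    fix \<epsilon> :: real assume "0 < \<epsilon>"
    then obtain K where K: "\<And>k. K \<le> k \<Longrightarrow> a k < \<epsilon> / 2"
      using order_tendstoD(2)[OF null, of "\<epsilon> / 2"] by (auto simp: eventually_sequentially)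
    have "\<omega> t < \<epsilon>" if "real K + 1 \<le> t" for t
    proof -
      have "\<omega> t \<le> \<epsilon> / 2"
      proof (rule least)
        fix k
        show "a k * p k t \<le> \<epsilon> / 2"
        proof (cases "K \<le> k")
          case True
          have "a k * p k t \<le> a k"
            using mult_left_mono[OF p01(2) nonneg] by force
          with K[OF True] show ?thesis by linarith
        next
          case False
          with that have "p k t = 0"
            by (auto simp: p_def)
          with \<open>0 < \<epsilon>\<close> show ?thesis by simp
        qed
      qed
      with \<open>0 < \<epsilon>\<close> show ?thesis by linarith
    qed
    then show "\<forall>\<^sub>F t in at_top. \<omega> t < \<epsilon>"
      unfolding eventually_at_top_linorder by blast
  next
    fix \<epsilon> :: real assume "\<epsilon> < 0"
    then have "\<epsilon> < \<omega> t" for t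
      using \<omega>0[of t] by linarith
    then show "\<forall>\<^sub>F t in at_top. \<epsilon> < \<omega> t"
      by simp
  qed
  have "a n \<le> \<omega> (real n)" for n
    using upper[of n "real n"] by (simp add: p_def)
  from that[OF cont anti \<omega>0 lim this] show thesis .
qed

text \<open>The bound is separable: \<open>r\<close> times a decreasing function of \<open>t\<close>, scaled so that for
  \<open>r0 > 0\<close> it lies above the envelope of \<open>a\<close> at \<open>r = r0\<close>.  Every
  function in \<open>KL\<close> vanishes at \<open>r = 0\<close>, which is why \<open>r0 = 0\<close> requires the zero sequence.\<close>

lemma KL_majorant_of_null_sequence:
  fixes a :: "nat \<Rightarrow> real"
  assumes nonneg: "\<And>n. 0 \<le> a n" and null: "a \<longlonglongrightarrow> 0"
    and r0: "0 \<le> r0" and degenerate: "\<And>n. r0 = 0 \<Longrightarrow> a n = 0"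
  shows "\<exists>\<beta>\<in>KL. \<forall>n. a n \<le> \<beta> r0 (real n)"
proof -
  \<comment> \<open>For \<open>r0 = 0\<close> any positive scale serves.\<close>
  define q where "q = (if r0 = 0 then 1 else r0)"
  have q: "0 < q"
    using r0 by (auto simp: q_def)
  obtain \<omega> where \<omega>: "continuous_on UNIV \<omega>" "antimono \<omega>" "\<And>t. 0 \<le> \<omega> t"
    "(\<omega> \<longlongrightarrow> 0) at_top" "\<And>n. a n \<le> \<omega> (real n)"
    using continuous_decreasing_envelope[OF nonneg null] by blast
  \<comment> \<open>The summand \<open>exp (- t)\<close> makes the nonincreasing envelope positive and strictly decreasing.\<close>
  define \<psi> where "\<psi> t = (\<omega> t + exp (- t)) / q" for t
  define \<beta> where "\<beta> r t = \<psi> t * r" for r t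
  have \<psi>_pos: "0 < \<psi> t" for t
    using \<omega>(3)[of t] q by (simp add: \<psi>_def add_nonneg_pos)
  have \<psi>_less: "\<psi> t' < \<psi> t" if "t < t'" for t t'
    using antimonoD[OF \<omega>(2), of t t'] that q
    by (auto simp: \<psi>_def intro!: divide_strict_right_mono add_le_less_mono)
  have \<psi>_cont: "continuous_on S \<psi>" for S
    unfolding \<psi>_def using q by (intro continuous_intros continuous_on_subset[OF \<omega>(1)]) auto
  have "((\<lambda>t. exp (- t)) \<longlongrightarrow> (0::real)) at_top"
    by (rule filterlim_compose[OF exp_at_bot filterlim_uminus_at_bot_at_top])
  then have "(\<psi> \<longlongrightarrow> (0 + 0) / q) at_top"
    unfolding \<psi>_def using q by (intro tendsto_intros \<omega>(4)) auto
  then have \<psi>_lim: "(\<psi> \<longlongrightarrow> 0) at_top"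
    by simp
  have "\<beta> \<in> KL"
    unfolding KL_def mem_Collect_eq
  proof (intro conjI allI impI)
    show "continuous_on ({0..} \<times> {0..}) (\<lambda>(r, t). \<beta> r t)"
      unfolding \<beta>_def split_beta
      by (intro continuous_intros continuous_on_compose2[OF \<psi>_cont[of UNIV]]) auto
    show "(\<lambda>r. \<beta> r t) \<in> K_inf" for t
      unfolding \<beta>_def by (rule linear_in_K_inf[OF \<psi>_pos])
    fix r :: real assume "0 < r"
    then show "strict_antimono_on {0..} (\<beta> r)"
      by (auto simp: \<beta>_def monotone_on_def intro: \<psi>_less)
    show "(\<beta> r \<longlongrightarrow> 0) at_top"
      unfolding \<beta>_def using tendsto_mult_right[OF \<psi>_lim, of r] by simp
  qed
  moreover have "a n \<le> \<beta> r0 (real n)" for n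
  proof (cases "r0 = 0")
    case True
    then show ?thesis
      using degenerate by (simp add: \<beta>_def)
  next
    case False
    then have "\<beta> r0 (real n) = \<omega> (real n) + exp (- real n)"
      by (simp add: \<beta>_def \<psi>_def q_def)
    then show ?thesis
      using \<omega>(5)[of n] exp_ge_zero[of "- real n"] by linarith
  qed
  ultimately show ?thesis by blast
qed

section \<open>Sequences split into blocks\<close>

lemma summable_of_telescoped_decrease:
  fixes v c :: "nat \<Rightarrow> real"
  assumes "0 < \<alpha>" and v: "\<And>i. 0 \<le> v i" and c: "\<And>i. 0 \<le> c i"
    and "Bseq (\<lambda>n. \<Sum>i\<le>n. v i - v (Suc i) - \<alpha> * c i)"
  shows "summable c"
proof -
  from assms(4) obtain B where B: "\<And>n. \<bar>\<Sum>i\<le>n. v i - v (Suc i) - \<alpha> * c i\<bar> \<le> B"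
    by (auto simp: Bseq_def)
  have "(\<Sum>i\<le>n. c i) \<le> (v 0 + B) / \<alpha>" for n
  proof -
    have "(\<Sum>i\<le>n. v i - v (Suc i) - \<alpha> * c i) = v 0 - v (Suc n) - \<alpha> * (\<Sum>i\<le>n. c i)"
      using sum_subtractf[of "\<lambda>i. v i - v (Suc i)" "\<lambda>i. \<alpha> * c i" "{..n}"]
      by (simp only: sum_telescope sum_distrib_left)
    with B[of n] v[of "Suc n"] have "\<alpha> * (\<Sum>i\<le>n. c i) \<le> v 0 + B"
      by linarith
    with \<open>0 < \<alpha>\<close> show ?thesis
      by (simp add: pos_le_divide_eq mult.commute)
  qed
  with c show ?thesis
    by (rule bounded_imp_summable)
qed

lemma strict_mono_block_decomposition:
  fixes \<sigma> :: "nat \<Rightarrow> nat"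
  assumes "strict_mono \<sigma>" and "\<sigma> 0 = 0"
  obtains i k where "n = \<sigma> i + k" and "n < \<sigma> (Suc i)"
proof -
  have "\<exists>i. \<sigma> i \<le> n \<and> n < \<sigma> (Suc i)"
  proof (induction n)
    case 0
    then show ?case
      using assms strict_monoD[OF assms(1), of 0 1] by (intro exI[of _ 0]) auto
  next
    case (Suc n)
    then obtain i where i: "\<sigma> i \<le> n" "n < \<sigma> (Suc i)" by blast
    show ?case
    proof (cases "Suc n < \<sigma> (Suc i)")
      case True
      with i show ?thesis by (intro exI[of _ i]) auto
    next
      case False
      with i have "\<sigma> (Suc i) = Suc n" by simp
      then show ?thesis
        using strict_monoD[OF assms(1), of "Suc i" "Suc (Suc i)"] by (intro exI[of _ "Suc i"]) auto
    qed
  qed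
  then obtain i where "\<sigma> i \<le> n" "n < \<sigma> (Suc i)" by blast
  then show thesis
    using that[of i "n - \<sigma> i"] by simp
qed

text \<open>Times from \<open>\<sigma> I\<close> on belong to blocks of index at least \<open>I\<close>, so a bound on whole blocks
  that vanishes with the block index vanishes with time.\<close>

lemma tendsto_zero_blockwise:
  fixes b c :: "nat \<Rightarrow> real" and \<sigma> :: "nat \<Rightarrow> nat"
  assumes \<sigma>: "strict_mono \<sigma>" "\<sigma> 0 = 0" and b: "\<And>n. 0 \<le> b n"
    and le: "\<And>i k. \<sigma> i + k < \<sigma> (Suc i) \<Longrightarrow> b (\<sigma> i + k) \<le> c i"
    and c: "c \<longlonglongrightarrow> 0"
  shows "b \<longlonglongrightarrow> 0"
proof (rule order_tendstoI)
  fix \<epsilon> :: real assume "0 < \<epsilon>"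
  with c obtain I where I: "\<And>i. I \<le> i \<Longrightarrow> c i < \<epsilon>"
    using order_tendstoD(2)[OF c] by (auto simp: eventually_sequentially)
  have "b n < \<epsilon>" if "\<sigma> I \<le> n" for n
  proof -
    obtain i k where ik: "n = \<sigma> i + k" "n < \<sigma> (Suc i)"
      using strict_mono_block_decomposition[OF \<sigma>] .
    from that ik(2) have "\<sigma> I < \<sigma> (Suc i)" by simp
    then have "I \<le> i"
      using strict_mono_less[OF \<sigma>(1)] by simp
    with I le[of i k] ik show ?thesis by fastforce
  qed
  then show "\<forall>\<^sub>F n in sequentially. b n < \<epsilon>"
    unfolding eventually_sequentially by blast
next
  fix \<epsilon> :: real assume "\<epsilon> < 0"
  then have "\<epsilon> < b n" for n
    using b[of n] by linarith
  then show "\<forall>\<^sub>F n in sequentially. \<epsilon> < b n"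
    by simp
qed

section \<open>Optimal trajectories\<close>

lemma V_eq_J_minimizer:
  assumes "is_minimizer XX UU f l N y u"
  shows "V XX UU f l N y = J f l N y u"
  unfolding V_def using assms
  by (intro cInf_eq_minimum) (auto simp: is_minimizer_def is_arg_min_linorder)

lemma minimizer_admissible:
  assumes "is_minimizer XX UU f l N y u"
  shows "k < N \<Longrightarrow> u k \<in> UU" and "y \<in> XX \<Longrightarrow> k \<le> N \<Longrightarrow> traj f u y k \<in> XX"
  using assms by (auto simp: is_minimizer_def is_arg_min_def admissible_def)
    (metis Suc_leI atLeastAtMost_iff neq0_conv traj.simps(1))

lemma l_star_le:
  assumes "\<And>y v. l y v \<ge> 0" and "v \<in> UU"
  shows "l_star UU l y \<le> l y v"
  unfolding l_star_def using assms by (intro cINF_lower) (auto simp: bdd_below_def)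

text \<open>Nonnegative stage costs with a nonpositive sum all vanish, and away from \<open>xstar\<close> they are
  positive.  At time \<open>N\<close> no cost is charged, so the argument stops at \<open>k < N\<close>; this covers the
  next update instant because blocks are shorter than the horizon.\<close>

lemma traj_stationary_of_J_nonpos:
  assumes l_nonneg: "\<And>y v. l y v \<ge> (0::real)" and l_pos: "\<And>y v. y \<noteq> xstar \<Longrightarrow> l y v > 0"
    and "J f l N y u \<le> 0" and "k < N"
  shows "traj f u y k = xstar"
proof -
  have "l (traj f u y k) (u k) \<le> J f l N y u"
    unfolding J_def using l_nonneg \<open>k < N\<close>
    by (intro member_le_sum[of k "{..<N}" "\<lambda>k. l (traj f u y k) (u k)"]) auto
  with \<open>J f l N y u \<le> 0\<close> l_pos[of "traj f u y k" "u k"] show ?thesis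
    by fastforce
qed

section \<open>Asymptotic stability of the closed loop\<close>

theorem theorem6p1:
  fixes dX :: "'x::banach \<Rightarrow> 'x \<Rightarrow> real" and dU :: "'u::banach \<Rightarrow> 'u \<Rightarrow> real"
    and XX :: "'x set" and UU :: "'u set"
    and f :: "'x \<Rightarrow> 'u \<Rightarrow> 'x" and l :: "'x \<Rightarrow> 'u \<Rightarrow> real"
    and xstar :: 'x and ustar :: 'u
    and N :: nat and uN :: "'x \<Rightarrow> nat \<Rightarrow> 'u"
    and \<sigma> m :: "nat \<Rightarrow> nat" and x0 :: 'x and x xmu :: "nat \<Rightarrow> 'x"
    and \<alpha> :: real and \<rho> s :: "nat \<Rightarrow> real" and \<alpha>1 \<alpha>2 :: "real \<Rightarrow> real"
  assumes metric_X: "Metric_space UNIV dX"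
    and metric_U: "Metric_space UNIV dU"
    and equilibrium: "xstar \<in> XX" "ustar \<in> UU" "f xstar ustar = xstar"
    and l_nonneg: "\<And>y v. l y v \<ge> 0"
    and l_continuous: "continuous_map
          (prod_topology (Metric_space.mtopology UNIV dX) (Metric_space.mtopology UNIV dU))
          euclideanreal (\<lambda>(y, v). l y v)"
    and l_equilibrium: "l xstar ustar = 0"
    and l_pos: "\<And>y v. y \<noteq> xstar \<Longrightarrow> l y v > 0"
    and viability: "\<And>y. y \<in> XX \<Longrightarrow> \<exists>v\<in>UU. f y v \<in> XX"
    and N_ge_2: "N \<ge> 2"
    and minimizer: "\<And>y. y \<in> XX \<Longrightarrow> is_minimizer XX UU f l N y (uN y)"
    and sigma_0: "\<sigma> 0 = 0"
    and m_def: "\<And>i. m i = \<sigma> (Suc i) - \<sigma> i"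
    and m_range: "\<And>i. m i \<in> {1..N - 1}"
    and x0: "x0 \<in> XX"
    and x_0: "x 0 = x0"
    and x_Suc: "\<And>i. x (Suc i) = traj f (uN (x i)) (x i) (m i)"
    and xmu: "\<And>i k. k < m i \<Longrightarrow> xmu (\<sigma> i + k) = traj f (uN (x i)) (x i) k"
    and alpha: "\<alpha> \<in> {0<..1}"
    and rho_def: "\<And>i. \<rho> i = V XX UU f l N (x i)
          - V XX UU f l N (traj f (uN (x i)) (x i) (m i))
          - \<alpha> * (\<Sum>k<m i. l (traj f (uN (x i)) (x i) k) (uN (x i) k))"
    and s_def: "\<And>n. s n = (\<Sum>i\<le>n. \<rho> i)"
    and K_inf: "\<alpha>1 \<in> K_inf" "\<alpha>2 \<in> K_inf"
    and upper: "\<And>i. \<alpha>2 (dX (x i) xstar) \<ge> V XX UU f l N (x i)"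
    and lower: "\<And>i. l_star UU l (x i) \<ge> \<alpha>1 (dX (x i) xstar)"
    and s_convergent: "convergent s"
  shows "limitin (Metric_space.mtopology UNIV dX) x xstar sequentially
    \<and> (\<forall>n. xmu n \<in> XX)
    \<and> behaves_like_as_on (range \<sigma>) dX XX xstar xmu
    \<and> ((\<exists>\<gamma>\<in>K_inf. \<forall>n. l_star UU l (xmu n) \<ge> \<gamma> (dX (xmu n) xstar))
          \<longrightarrow> behaves_like_as dX XX xstar xmu)
    \<and> (\<lambda>i. V XX UU f l N (x i)) \<longlonglongrightarrow> 0"
proof -
  interpret X: Metric_space UNIV dX by (fact metric_X)
  have \<sigma>_Suc: "\<sigma> (Suc i) = \<sigma> i + m i" for i
    using m_def[of i] m_range[of i] by (simp only: atLeastAtMost_iff) linarith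
  then have \<sigma>_mono: "strict_mono \<sigma>"
    using m_range by (auto simp: strict_mono_Suc_iff Suc_le_eq)
  have m_less: "m i < N" and m_pos: "0 < m i" for i
    using m_range[of i] N_ge_2 by auto
  have block: thesis if "\<And>i k. n = \<sigma> i + k \<Longrightarrow> k < m i \<Longrightarrow> thesis" for n thesis
    using strict_mono_block_decomposition[OF \<sigma>_mono sigma_0, of n] that \<sigma>_Suc by fastforce

  have x_in: "x i \<in> XX" for i
  proof (induction i)
    case 0
    show ?case using x0 x_0 by simp
  next
    case (Suc i)
    then show ?case
      using minimizer_admissible(2)[OF minimizer, of "x i" "m i"] m_less[of i] by (simp add: x_Suc)
  qed
  have xmu_in: "xmu n \<in> XX" for n
  proof (rule block[of n])
    fix i k assume n: "n = \<sigma> i + k" and k: "k < m i"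
    then show "xmu n \<in> XX"
      using minimizer_admissible(2)[OF minimizer[OF x_in] x_in, of k i] m_less[of i]
      by (simp add: xmu)
  qed
  have xmu_\<sigma>: "xmu (\<sigma> i) = x i" for i
    using xmu[of 0 i] m_pos by simp
  have xmu_0: "xmu 0 = x 0"
    using xmu_\<sigma>[of 0] sigma_0 by simp

  define v where "v i = V XX UU f l N (x i)" for i
  define c where "c i = (\<Sum>k<m i. l (traj f (uN (x i)) (x i) k) (uN (x i) k))" for i
  have v_J: "v i = J f l N (x i) (uN (x i))" for i
    unfolding v_def by (rule V_eq_J_minimizer[OF minimizer[OF x_in]])
  have v_nonneg: "0 \<le> v i" for i
    unfolding v_J J_def by (intro sum_nonneg l_nonneg)
  have c_nonneg: "0 \<le> c i" for i
    unfolding c_def by (intro sum_nonneg l_nonneg)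
  have "s = (\<lambda>n. \<Sum>i\<le>n. v i - v (Suc i) - \<alpha> * c i)"
    by (simp add: fun_eq_iff s_def rho_def v_def c_def x_Suc)
  then have "summable c"
    using convergent_imp_Bseq[OF s_convergent] alpha v_nonneg c_nonneg
    by (intro summable_of_telescoped_decrease[of \<alpha> v c]) auto
  then have c_lim: "c \<longlonglongrightarrow> 0"
    by (rule summable_LIMSEQ_zero)

  have l_star_le_c: "l_star UU l (xmu (\<sigma> i + k)) \<le> c i" if "k < m i" for i k
  proof -
    have "uN (x i) k \<in> UU"
      using minimizer_admissible(1)[OF minimizer[OF x_in]] that m_less[of i] by simp
    then have "l_star UU l (xmu (\<sigma> i + k)) \<le> l (traj f (uN (x i)) (x i) k) (uN (x i) k)"
      unfolding xmu[OF that] by (intro l_star_le l_nonneg)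
    also have "\<dots> \<le> c i"
      unfolding c_def using that l_nonneg
      by (intro member_le_sum[of k _ "\<lambda>k. l (traj f (uN (x i)) (x i) k) (uN (x i) k)"]) auto
    finally show ?thesis .
  qed

  have "(\<lambda>i. \<alpha>1 (dX (x i) xstar)) \<longlonglongrightarrow> 0"
  proof (rule tendsto_sandwich[OF _ _ tendsto_const c_lim])
    show "\<forall>\<^sub>F i in sequentially. 0 \<le> \<alpha>1 (dX (x i) xstar)"
      using K_inf_nonneg[OF K_inf(1)] by simp
    show "\<forall>\<^sub>F i in sequentially. \<alpha>1 (dX (x i) xstar) \<le> c i"
      using order_trans[OF lower] l_star_le_c[OF m_pos] xmu_\<sigma> by simp
  qed
  then have d_lim: "(\<lambda>i. dX (x i) xstar) \<longlonglongrightarrow> 0"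
    by (rule tendsto_zero_of_K_inf[OF K_inf(1) X.nonneg])
  then have x_lim: "limitin X.mtopology x xstar sequentially"
    by (simp add: X.limitin_metric_dist_null)
  have v_lim: "v \<longlonglongrightarrow> 0"
  proof (rule tendsto_sandwich[OF _ _ tendsto_const])
    show "\<forall>\<^sub>F i in sequentially. 0 \<le> v i"
      using v_nonneg by simp
    show "\<forall>\<^sub>F i in sequentially. v i \<le> \<alpha>2 (dX (x i) xstar)"
      using upper by (simp add: v_def)
    show "(\<lambda>i. \<alpha>2 (dX (x i) xstar)) \<longlonglongrightarrow> 0"
      by (rule K_inf_tendsto_zero[OF K_inf(2) _ d_lim]) simp
  qed

  have stationary: "xmu n = xstar" if "x 0 = xstar" for n
  proof -
    have traj_stationary: "traj f (uN (x i)) (x i) k = xstar" if "x i = xstar" "k < N" for i k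
    proof (rule traj_stationary_of_J_nonpos[OF l_nonneg l_pos _ \<open>k < N\<close>])
      show "J f l N (x i) (uN (x i)) \<le> 0"
        using upper[of i] that(1) v_J[of i] K_inf_zero[OF K_inf(2)] by (simp add: v_def)
    qed
    have x_stationary: "x i = xstar" for i
      by (induction i) (use \<open>x 0 = xstar\<close> traj_stationary m_less in \<open>auto simp: x_Suc\<close>)
    show ?thesis
    proof (rule block[of n])
      fix i k assume n: "n = \<sigma> i + k" and k: "k < m i"
      then show "xmu n = xstar"
        using traj_stationary[OF x_stationary, of k i] m_less[of i] by (simp add: xmu)
    qed
  qed

  \<comment> \<open>One argument covers the update instants and all times: where no bound is claimed, the
    distance is replaced by \<open>0\<close>, which changes neither nonnegativity nor the blockwise bound.\<close>
  have stable: "behaves_like_as_on T dX XX xstar xmu"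
    if \<gamma>: "\<gamma> \<in> K_inf" and bound: "\<And>n. n \<in> T \<Longrightarrow> \<gamma> (dX (xmu n) xstar) \<le> l_star UU l (xmu n)"
    for T \<gamma>
  proof -
    define a where "a n = (if n \<in> T then dX (xmu n) xstar else 0)" for n
    have a_nonneg: "0 \<le> a n" for n
      by (simp add: a_def)
    have "(\<lambda>n. \<gamma> (a n)) \<longlonglongrightarrow> 0"
    proof (rule tendsto_zero_blockwise[OF \<sigma>_mono sigma_0 _ _ c_lim])
      show "0 \<le> \<gamma> (a n)" for n
        by (rule K_inf_nonneg[OF \<gamma> a_nonneg])
      show "\<gamma> (a (\<sigma> i + k)) \<le> c i" if "\<sigma> i + k < \<sigma> (Suc i)" for i k
        using that order_trans[OF bound l_star_le_c] c_nonneg[of i]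
        by (simp add: a_def \<sigma>_Suc K_inf_zero[OF \<gamma>])
    qed
    then have "a \<longlonglongrightarrow> 0"
      by (rule tendsto_zero_of_K_inf[OF \<gamma> a_nonneg])
    moreover have "a n = 0" if "dX (xmu 0) xstar = 0" for n
      using that stationary xmu_0 by (simp add: a_def)
    ultimately have "\<exists>\<beta>\<in>KL. \<forall>n. a n \<le> \<beta> (dX (xmu 0) xstar) (real n)"
      using a_nonneg by (intro KL_majorant_of_null_sequence) auto
    then show ?thesis
      unfolding behaves_like_as_on_def using xmu_in by (metis a_def)
  qed
  have "behaves_like_as_on (range \<sigma>) dX XX xstar xmu"
    using lower by (intro stable[OF K_inf(1)]) (auto simp: xmu_\<sigma>)
  moreover have "behaves_like_as dX XX xstar xmu"
    if "\<exists>\<gamma>\<in>K_inf. \<forall>n. l_star UU l (xmu n) \<ge> \<gamma> (dX (xmu n) xstar)"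
    using that stable by blast
  ultimately show ?thesis
    using x_lim xmu_in v_lim unfolding v_def by blast
qed

end
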